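(* Let $r\ge 1$ and $n\ge1$ be integers and let $\mathcal{H}=(V,E)$ be an $r$-uniform $r$-equipartite hypergraph with $rn$ vertices: $V=C_1\cup\cdots\cup C_r$ is a partition into $r$ classes with $|C_i|=n$ for every $i$, and every edge $A\in E$ satisfies $|A\cap C_i|=1$ for every $i$. Let $g$ be a semi-threshold function on $\{-1,1\}^r$ satisfying $\mathbb{E}_{\mu_{1/2}}[|g|]\le |E|/n^r$ with $\mathbb{E}_{\mu_{1/2}}[|g|]$ as large as possible among such semi-threshold functions. Then \[ X(\mathcal{H}) \le \overline{X}_{\mu_{1/2}}(g)\, n^{r-1}, \] i.e. for every $f:E\to\{-1,1\}$ with $\sum_{A\in E}f(A)=0$ we have $\min_{v\in V}\big|\sum_{A\ni v} f(A)\big| \le \overline{X}_{\mu_{1/2}}(g)\, n^{r-1}$.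
   Context: For a hypergraph $\mathcal{H}=(V,E)$ and $f:E\to\{-1,1\}$, $X(f)=\min_{v\in V}|\sum_{A\ni v} f(A)|$, and $X(\mathcal{H})$ is the maximum of $X(f)$ over all $f:E\to\{-1,1\}$ with $\sum_{A\in E}f(A)=0$. On $\{-1,1\}^r$, $\mu_{1/2}$ denotes the uniform product measure (each $x_i=1$ with probability $1/2$ independently), and $\mathbb{E}_{\mu}$ denotes expectation with respect to $\mu$. For $h:\{-1,1\}^r\to[-1,1]$ and a product measure $\mu$ with all marginals in $(0,1)$, \[ \overline{X}_\mu(h)=\min_{1\le i\le r}\min\big\{\mathbb{E}_\mu[h\mid x_i=1],\,-\mathbb{E}_\mu[h\mid x_i=-1]\big\}. \] For $x\in\{-1,1\}^r$ write $|x|=\sum_i x_i$. A semi-threshold function is a function $h:\{-1,1\}^r\to[-1,1]$ of the form $h(x)=1$ if $|x|>k$, $h(x)=\beta$ if $|x|=k$, $h(x)=0$ if $-k<|x|<k$, $h(x)=-\beta$ if $|x|=-k$, $h(x)=-1$ if $|x|<-k$, for some integer $k\ge 0$ and $\beta\in[0,1]$ (with $\beta=0$ when $k=0$). *)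

theory Defs
  imports "HOL-Probability.Probability" "HOL-Probability.Product_PMF" "HOL-Library.Disjoint_Sets"
begin

definition uniform_equipartite_hypergraph ::
    "nat \<Rightarrow> nat \<Rightarrow> 'v set \<Rightarrow> 'v set set \<Rightarrow> (nat \<Rightarrow> 'v set) \<Rightarrow> bool" where
  "uniform_equipartite_hypergraph r n V E C \<longleftrightarrow>
     finite V \<and> E \<subseteq> Pow V \<and>
     (\<forall>A\<in>E. card A = r) \<and>
     V = (\<Union>i\<in>{1..r}. C i) \<and> disjoint_family_on C {1..r} \<and>
     (\<forall>i\<in>{1..r}. card (C i) = n) \<and>
     (\<forall>A\<in>E. \<forall>i\<in>{1..r}. card (A \<inter> C i) = 1)"

definition colouring_X :: "'v set \<Rightarrow> 'v set set \<Rightarrow> ('v set \<Rightarrow> int) \<Rightarrow> int" where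
  "colouring_X V E f = Min ((\<lambda>v. \<bar>\<Sum>A | A \<in> E \<and> v \<in> A. f A\<bar>) ` V)"

definition balanced_colourings :: "'v set set \<Rightarrow> ('v set \<Rightarrow> int) set" where
  "balanced_colourings E = {f \<in> E \<rightarrow>\<^sub>E {-1, 1}. (\<Sum>A\<in>E. f A) = 0}"

text \<open>
  There is no balanced colouring when the number of edges is odd; the maximum is
  meaningful only if \<^term>\<open>balanced_colourings E\<close> is nonempty.
\<close>

definition hypergraph_X :: "'v set \<Rightarrow> 'v set set \<Rightarrow> int" where
  "hypergraph_X V E = Max (colouring_X V E ` balanced_colourings E)"

text \<open>
  Points of the cube are extensional functions on \<^term>\<open>{1..r}\<close>, so
  \<^term>\<open>undefined\<close> is the default value of the product measure outside the index set.
\<close>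

definition sign_cube :: "nat \<Rightarrow> (nat \<Rightarrow> int) set" where
  "sign_cube r = {1..r} \<rightarrow>\<^sub>E {-1, 1}"

definition cube_pmf :: "nat \<Rightarrow> (nat \<Rightarrow> real) \<Rightarrow> (nat \<Rightarrow> int) pmf" where
  "cube_pmf r p =
     Pi_pmf {1..r} undefined (\<lambda>i. map_pmf (\<lambda>b. if b then 1 else -1) (bernoulli_pmf (p i)))"

abbreviation mu_half :: "nat \<Rightarrow> (nat \<Rightarrow> int) pmf" where
  "mu_half r \<equiv> cube_pmf r (\<lambda>_. 1/2)"

lemma set_cube_pmf:
  assumes "\<And>i. i \<in> {1..r} \<Longrightarrow> 0 < p i \<and> p i < 1"
  shows "set_pmf (cube_pmf r p) = sign_cube r"
proof -
  have "set_pmf (cube_pmf r p) = PiE_dflt {1..r} undefined (\<lambda>_. {-1, 1})"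
    unfolding cube_pmf_def
    by (subst set_Pi_pmf) (use assms in \<open>auto simp: PiE_dflt_def set_pmf_bernoulli\<close>)
  also have "\<dots> = sign_cube r"
    by (auto simp: PiE_dflt_def sign_cube_def PiE_def Pi_def extensional_def)
  finally show ?thesis .
qed

definition X_bar :: "nat \<Rightarrow> (nat \<Rightarrow> int) pmf \<Rightarrow> ((nat \<Rightarrow> int) \<Rightarrow> real) \<Rightarrow> real" where
  "X_bar r M h = Min ((\<lambda>i. min (measure_pmf.expectation (cond_pmf M {x. x i = 1}) h)
                               (- measure_pmf.expectation (cond_pmf M {x. x i = -1}) h)) ` {1..r})"

text \<open>Only the values of \<open>h\<close> on the cube matter; elsewhere \<open>h\<close> is unconstrained.\<close>

definition semi_threshold :: "nat \<Rightarrow> ((nat \<Rightarrow> int) \<Rightarrow> real) \<Rightarrow> bool" where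
  "semi_threshold r h \<longleftrightarrow>
     (\<exists>(k::int) (\<beta>::real). 0 \<le> k \<and> 0 \<le> \<beta> \<and> \<beta> \<le> 1 \<and> (k = 0 \<longrightarrow> \<beta> = 0) \<and>
       (\<forall>x\<in>sign_cube r.
          let s = (\<Sum>i = 1..r. x i) in
          h x = (if s > k then 1
                 else if s = k then \<beta>
                 else if - k < s then 0
                 else if s = - k then - \<beta>
                 else - 1)))"

end

theory Submission
  imports Defs
begin

text \<open>
  Let \<open>m\<close> be the least absolute vertex sum \<open>\<bar>d v\<bar>\<close> of a balanced colouring. The vertex
  sums of each class add up to zero, so weights \<open>e v\<close> in \<open>[-1, 1]\<close>, constant on the
  positive and on the negative vertices, can be chosen with sum zero over the class and
  \<open>\<Sum> e v * d v \<ge> m * n\<close>. Summing over the classes, \<open>r * m * n\<close> is at most the sum over the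
  edges \<open>A\<close> of \<open>\<bar>\<Sum>v\<in>A. e v\<bar>\<close>. Rounding every weight to an independent sign with that mean
  turns a random transversal into a uniform point \<open>x\<close> of the cube. With \<open>S x\<close> the
  coordinate sum of \<open>x\<close> (the \<open>\<bar>x\<bar>\<close> of the paper), Jensen's inequality and
  \<open>\<bar>S x\<bar> \<le> k + max 0 (\<bar>S x\<bar> - k)\<close> bound the sum over the edges by
  \<open>k * card E\<close> plus \<open>n ^ r\<close> times the mean of \<open>max 0 (\<bar>S x\<bar> - k)\<close>. For the threshold
  \<open>k\<close> of the maximal \<open>g\<close> this is \<open>n ^ r\<close> times the mean of \<open>g x * S x\<close>, which
  by symmetry is \<open>r * X_bar g\<close>.
\<close>

section \<open>Balancing weights on one class\<close>

lemma exists_balancing_weights: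
  fixes d :: "'a \<Rightarrow> real"
  assumes fin: "finite C" and ne: "C \<noteq> {}" and sum0: "(\<Sum>v\<in>C. d v) = 0"
    and m: "\<And>v. v \<in> C \<Longrightarrow> m \<le> \<bar>d v\<bar>"
  shows "\<exists>e. (\<forall>v\<in>C. \<bar>e v\<bar> \<le> 1) \<and> (\<Sum>v\<in>C. e v) = 0 \<and>
    m * real (card C) \<le> (\<Sum>v\<in>C. e v * d v)"
proof -
  define P where "P = {v\<in>C. d v \<ge> 0}"
  define N where "N = {v\<in>C. d v < 0}"
  define a where "a = real (card P)"
  define b where "b = real (card N)"
  define M where "M = max a b"
  define D where "D = (\<Sum>v\<in>P. d v)"
  \<comment> \<open>The weights \<open>b / M\<close> on \<open>a\<close> points and
    \<open>- a / M\<close> on \<open>b\<close> points cancel; dividing by the larger count keeps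
    both in [-1, 1].\<close>
  define e where "e = (\<lambda>v. if d v \<ge> 0 then b / M else - a / M)"
  have C: "C = P \<union> N" "P \<inter> N = {}" "finite P" "finite N"
    using fin by (auto simp: P_def N_def)
  have split: "(\<Sum>v\<in>C. F v) = (\<Sum>v\<in>P. F v) + (\<Sum>v\<in>N. F v)" for F :: "'a \<Rightarrow> real"
    unfolding C(1) using C by (intro sum.union_disjoint) auto
  have cardC: "real (card C) = a + b"
    using C by (simp add: a_def b_def card_Un_disjoint)
  moreover have "real (card C) > 0" using fin ne by (simp add: card_gt_0_iff)
  ultimately have M: "M > 0" "a \<le> M" "b \<le> M" "0 \<le> a" "0 \<le> b"
    by (auto simp: M_def a_def b_def)
  have DN: "(\<Sum>v\<in>N. d v) = - D" using split[of d] sum0 by (simp add: D_def)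
  have "(\<Sum>v\<in>P. m) \<le> D" unfolding D_def
    using m by (intro sum_mono) (force simp: P_def)
  hence ma: "m * a \<le> D" by (simp add: a_def mult.commute)
  have "(\<Sum>v\<in>N. m) \<le> (\<Sum>v\<in>N. - d v)"
    using m by (intro sum_mono) (force simp: N_def)
  hence mb: "m * b \<le> D" using DN by (simp add: b_def mult.commute sum_negf)
  \<comment> \<open>As \<open>d\<close> sums to zero, its positive and negative parts have the same
    mass \<open>D\<close>, which is at least \<open>m\<close> times either count and so at least
    \<open>m\<close> times the larger one.\<close>
  have mM: "m * M \<le> D" using ma mb by (simp add: M_def max_def)
  have eP: "(\<Sum>v\<in>P. e v * F v) = b / M * (\<Sum>v\<in>P. F v)" for F
    unfolding sum_distrib_left by (intro sum.cong) (auto simp: e_def P_def)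
  have eN: "(\<Sum>v\<in>N. e v * F v) = - a / M * (\<Sum>v\<in>N. F v)" for F
    unfolding sum_distrib_left by (intro sum.cong) (auto simp: e_def N_def)
  have "(\<Sum>v\<in>C. e v) = 0"
    using eP[of "\<lambda>_. 1"] eN[of "\<lambda>_. 1"] by (simp add: split a_def[symmetric] b_def[symmetric])
  moreover have "\<forall>v\<in>C. \<bar>e v\<bar> \<le> 1" using M by (auto simp: e_def)
  moreover have "(\<Sum>v\<in>C. e v * d v) = D / M * (a + b)"
    using M by (simp add: split eP eN DN flip: D_def) (simp add: field_simps)
  moreover have "m * (a + b) \<le> D / M * (a + b)"
    using M mM by (intro mult_right_mono) (auto simp: field_simps)
  ultimately show ?thesis unfolding cardC by metis
qed

section \<open>The sign cube and its uniform measure\<close>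

lemma finite_sign_cube [simp]: "finite (sign_cube r)"
  by (simp add: sign_cube_def finite_PiE)

lemma card_sign_cube: "card (sign_cube r) = 2 ^ r"
  by (simp add: sign_cube_def card_PiE flip: numeral_2_eq_2)

lemma sign_cube_nonempty: "sign_cube r \<noteq> {}"
  using card_sign_cube[of r] by (metis card.empty power_not_zero zero_neq_numeral)

lemma sign_cube_coord: "x \<in> sign_cube r \<Longrightarrow> i \<in> {1..r} \<Longrightarrow> x i = -1 \<or> x i = 1"
  by (auto simp: sign_cube_def PiE_def Pi_def)

lemma cond_pmf_of_set:
  assumes fin: "finite A" and ne: "A \<inter> B \<noteq> {}"
  shows "cond_pmf (pmf_of_set A) B = pmf_of_set (A \<inter> B)"
proof (rule pmf_eqI)
  fix x
  have A: "A \<noteq> {}" using ne by auto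
  show "pmf (cond_pmf (pmf_of_set A) B) x = pmf (pmf_of_set (A \<inter> B)) x"
    using fin ne A
    by (auto simp: pmf_cond measure_pmf_of_set card_gt_0_iff indicator_def)
qed

text \<open>This turns expectations into finite sums over the cube, on which symmetries act by
  reindexing.\<close>

lemma mu_half_eq_pmf_of_set: "mu_half r = pmf_of_set (sign_cube r)"
proof -
  have "map_pmf (\<lambda>b. if b then 1 else -1) (bernoulli_pmf (1/2)) = pmf_of_set {-1, 1::int}"
    unfolding bernoulli_pmf_half_conv_pmf_of_set
    by (subst map_pmf_of_set_inj) (auto simp: inj_on_def UNIV_bool)
  moreover have "PiE_dflt {1..r} undefined (\<lambda>_. {-1, 1}) = sign_cube r"
    by (auto simp: PiE_dflt_def sign_cube_def PiE_def Pi_def extensional_def)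
  ultimately show ?thesis
    unfolding cube_pmf_def by (simp add: Pi_pmf_of_set)
qed

lemma expectation_mu_half:
  fixes F :: "(nat \<Rightarrow> int) \<Rightarrow> real"
  shows "measure_pmf.expectation (mu_half r) F = (\<Sum>x\<in>sign_cube r. F x) / 2 ^ r"
  unfolding mu_half_eq_pmf_of_set
  by (subst integral_pmf_of_set) (auto simp: sign_cube_nonempty card_sign_cube)

section \<open>Random rounding of transversals\<close>

text \<open>
  Each vertex \<open>t i\<close> is rounded to a random sign with mean \<open>e i (t i)\<close>. Since the
  means cancel over every class, a uniformly random transversal gives a uniformly random
  point of the cube.
\<close>

lemma sum_abs_transversal_weights_le:
  fixes C :: "nat \<Rightarrow> 'v set" and e :: "nat \<Rightarrow> 'v \<Rightarrow> real"
  assumes fin: "\<And>i. i \<in> {1..r} \<Longrightarrow> finite (C i)"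
    and card: "\<And>i. i \<in> {1..r} \<Longrightarrow> card (C i) = n"
    and e1: "\<And>i v. i \<in> {1..r} \<Longrightarrow> v \<in> C i \<Longrightarrow> \<bar>e i v\<bar> \<le> 1"
    and e0: "\<And>i. i \<in> {1..r} \<Longrightarrow> (\<Sum>v\<in>C i. e i v) = 0"
    and T: "T \<subseteq> (\<Pi>\<^sub>E i\<in>{1..r}. C i)"
  shows "(\<Sum>t\<in>T. \<bar>\<Sum>i=1..r. e i (t i)\<bar>) \<le>
    k * real (card T) +
    real n ^ r * ((\<Sum>x\<in>sign_cube r. max 0 (\<bar>real_of_int (\<Sum>i=1..r. x i)\<bar> - k)) / 2 ^ r)"
proof -
  let ?Q = "\<Pi>\<^sub>E i\<in>{1..r}. C i"
  \<comment> \<open>The probability that rounding \<open>t\<close> gives \<open>x\<close>: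
    coordinate \<open>i\<close> becomes the sign \<open>s\<close> with probability
    \<open>(1 + s * e i (t i)) / 2\<close>.\<close>
  define W where "W = (\<lambda>t (x :: nat \<Rightarrow> int). \<Prod>i=1..r. (1 + real_of_int (x i) * e i (t i)) / 2)"
  define S where "S = (\<lambda>x :: nat \<Rightarrow> int. real_of_int (\<Sum>i=1..r. x i))"
  define \<phi> where "\<phi> = (\<lambda>x. max 0 (\<bar>S x\<bar> - k))"
  have finQ: "finite ?Q" using fin by (intro finite_PiE) auto
  have W_nonneg: "W t x \<ge> 0" if "t \<in> ?Q" "x \<in> sign_cube r" for t x
    unfolding W_def
  proof (intro prod_nonneg)
    fix i assume i: "i \<in> {1..r}"
    have "\<bar>e i (t i)\<bar> \<le> 1" using e1[OF i] that(1) i by (auto simp: PiE_def Pi_def)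
    then show "0 \<le> (1 + real_of_int (x i) * e i (t i)) / 2"
      using sign_cube_coord[OF that(2) i] by auto
  qed
  have W_sum: "(\<Sum>x\<in>sign_cube r. W t x) = 1" for t
  proof -
    have "(\<Sum>x\<in>sign_cube r. W t x) =
        (\<Prod>i=1..r. \<Sum>s\<in>{-1,1::int}. (1 + real_of_int s * e i (t i)) / 2)"
      unfolding W_def sign_cube_def by (subst prod_sum_PiE) auto
    also have "\<dots> = 1" by (intro prod.neutral) (auto simp: field_simps)
    finally show ?thesis .
  qed
  have W_mean: "(\<Sum>x\<in>sign_cube r. W t x * real_of_int (x j)) = e j (t j)"
    if j: "j \<in> {1..r}" for t j
  proof -
    \<comment> \<open>Absorbing \<open>x j\<close> into the factor \<open>j\<close> lets the sum
      over the cube factorise again; every other factor sums to 1.\<close>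
    let ?F = "\<lambda>i s. (1 + real_of_int s * e i (t i)) / 2 * (if i = j then real_of_int s else 1)"
    have "W t x * real_of_int (x j) = (\<Prod>i=1..r. ?F i (x i))" for x
      unfolding W_def prod.distrib using j by (simp add: prod.delta)
    then have "(\<Sum>x\<in>sign_cube r. W t x * real_of_int (x j)) =
        (\<Sum>x\<in>sign_cube r. \<Prod>i=1..r. ?F i (x i))" by simp
    also have "\<dots> = (\<Prod>i=1..r. \<Sum>s\<in>{-1,1::int}. ?F i s)"
      unfolding sign_cube_def by (subst prod_sum_PiE) auto
    also have "\<dots> = (\<Prod>i=1..r. if i = j then e i (t i) else 1)"
      by (intro prod.cong) (auto simp: field_simps)
    also have "\<dots> = e j (t j)" using j by (simp add: prod.delta)
    finally show ?thesis .
  qed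
  \<comment> \<open>The total weight over all transversals is the same for every \<open>x\<close>,
    since the means cancel within each class. This is the uniformity of the rounded point.\<close>
  have W_transv: "(\<Sum>t\<in>?Q. W t x) = real n ^ r / 2 ^ r" for x
  proof -
    have "(\<Sum>t\<in>?Q. W t x) = (\<Prod>i=1..r. \<Sum>v\<in>C i. (1 + real_of_int (x i) * e i v) / 2)"
      unfolding W_def using fin by (subst prod_sum_PiE) auto
    also have "\<dots> = (\<Prod>i=1..r. real n / 2)"
    proof (intro prod.cong refl)
      fix i assume i: "i \<in> {1..r}"
      have "(\<Sum>v\<in>C i. (1 + real_of_int (x i) * e i v) / 2) =
          (real (card (C i)) + real_of_int (x i) * (\<Sum>v\<in>C i. e i v)) / 2"
        by (simp add: sum.distrib sum_distrib_left flip: sum_divide_distrib)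
      then show "(\<Sum>v\<in>C i. (1 + real_of_int (x i) * e i v) / 2) = real n / 2"
        using e0[OF i] card[OF i] by simp
    qed
    finally show ?thesis by (simp add: power_divide)
  qed
  have W_S: "(\<Sum>x\<in>sign_cube r. W t x * S x) = (\<Sum>i=1..r. e i (t i))" for t
  proof -
    have "(\<Sum>x\<in>sign_cube r. W t x * S x) =
        (\<Sum>x\<in>sign_cube r. \<Sum>i=1..r. W t x * real_of_int (x i))"
      by (simp add: S_def sum_distrib_left)
    also have "\<dots> = (\<Sum>i=1..r. \<Sum>x\<in>sign_cube r. W t x * real_of_int (x i))"
      by (rule sum.swap)
    also have "\<dots> = (\<Sum>i=1..r. e i (t i))" by (intro sum.cong refl W_mean)
    finally show ?thesis .
  qed
  \<comment> \<open>By \<open>W_S\<close> the left side is the absolute value of the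
    \<open>W t\<close>-mean of \<open>S\<close>; Jensen's inequality and
    \<open>\<bar>S x\<bar> \<le> k + \<phi> x\<close> apply.\<close>
  have point: "\<bar>\<Sum>i=1..r. e i (t i)\<bar> \<le> k + (\<Sum>x\<in>sign_cube r. W t x * \<phi> x)" if t: "t \<in> ?Q" for t
  proof -
    have "\<bar>\<Sum>i=1..r. e i (t i)\<bar> \<le> (\<Sum>x\<in>sign_cube r. \<bar>W t x * S x\<bar>)"
      unfolding W_S[symmetric] by (rule sum_abs)
    also have "\<dots> \<le> (\<Sum>x\<in>sign_cube r. W t x * (k + \<phi> x))"
      using W_nonneg[OF t] by (intro sum_mono) (auto simp: abs_mult \<phi>_def intro!: mult_left_mono)
    also have "\<dots> = k * (\<Sum>x\<in>sign_cube r. W t x) + (\<Sum>x\<in>sign_cube r. W t x * \<phi> x)"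
      by (simp add: distrib_left sum.distrib sum_distrib_left mult.commute)
    finally show ?thesis by (simp add: W_sum)
  qed
  have "(\<Sum>t\<in>T. \<bar>\<Sum>i=1..r. e i (t i)\<bar>) \<le> (\<Sum>t\<in>T. k + (\<Sum>x\<in>sign_cube r. W t x * \<phi> x))"
    using T by (intro sum_mono point) auto
  also have "\<dots> = k * real (card T) + (\<Sum>t\<in>T. \<Sum>x\<in>sign_cube r. W t x * \<phi> x)"
    by (simp add: sum.distrib mult.commute)
  \<comment> \<open>Only the nonnegative excess is extended from \<open>T\<close> to all
    transversals, where uniformity is available; the term with \<open>k\<close> keeps the factor
    \<open>card T\<close>.\<close>
  also have "(\<Sum>t\<in>T. \<Sum>x\<in>sign_cube r. W t x * \<phi> x) \<le> (\<Sum>t\<in>?Q. \<Sum>x\<in>sign_cube r. W t x * \<phi> x)"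
    using T W_nonneg by (intro sum_mono2 finQ sum_nonneg mult_nonneg_nonneg) (auto simp: \<phi>_def)
  also have "\<dots> = (\<Sum>x\<in>sign_cube r. (\<Sum>t\<in>?Q. W t x) * \<phi> x)"
    by (subst sum.swap) (simp add: sum_distrib_right)
  also have "\<dots> = real n ^ r * ((\<Sum>x\<in>sign_cube r. \<phi> x) / 2 ^ r)"
    unfolding W_transv by (simp add: sum_distrib_left sum_divide_distrib)
  finally show ?thesis by (simp add: \<phi>_def S_def)
qed

section \<open>Profiles of semi-threshold functions\<close>

text \<open>Isolating the dependence on the coordinate sum reduces facts about semi-threshold
  functions to cases on one integer.\<close>

definition threshold_value :: "int \<Rightarrow> real \<Rightarrow> int \<Rightarrow> real" where
  "threshold_value k \<beta> s = (if s > k then 1 else if s = k then \<beta> else if - k < s then 0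
     else if s = - k then - \<beta> else - 1)"

lemma semi_threshold_iff:
  "semi_threshold r h \<longleftrightarrow> (\<exists>k \<beta>. 0 \<le> k \<and> 0 \<le> \<beta> \<and> \<beta> \<le> 1 \<and> (k = 0 \<longrightarrow> \<beta> = 0) \<and>
     (\<forall>x\<in>sign_cube r. h x = threshold_value k \<beta> (\<Sum>i=1..r. x i)))"
  by (simp add: semi_threshold_def threshold_value_def Let_def)

lemma threshold_value_uminus:
  "0 \<le> k \<Longrightarrow> (k = 0 \<Longrightarrow> \<beta> = 0) \<Longrightarrow> threshold_value k \<beta> (- s) = - threshold_value k \<beta> s"
  by (auto simp: threshold_value_def)

text \<open>Above the threshold the profile is the sign of \<open>s\<close>, below it is 0. On the
  level itself the two terms on the right cancel whatever \<open>\<beta>\<close> is.\<close>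

lemma threshold_value_excess:
  assumes "0 \<le> k" "0 \<le> \<beta>"
  shows "max 0 (\<bar>real_of_int s\<bar> - real_of_int k) =
    threshold_value k \<beta> s * real_of_int s - real_of_int k * \<bar>threshold_value k \<beta> s\<bar>"
proof -
  consider "s > k" | "s = k" | "- k < s" "s < k" | "s = - k" "k > 0" | "s < - k"
    using assms by linarith
  then show ?thesis
    using assms by cases (auto simp: threshold_value_def max_def)
qed

text \<open>
  The parameters of a semi-threshold function are not unique: the level \<open>\<bar>x\<bar> = k\<close> may be
  empty or have full weight. Lowering \<open>k\<close> rules this out, so that the weight of the
  level can be increased.
\<close>

lemma semi_threshold_obtain_canonical:
  assumes "semi_threshold r h"
  obtains k \<beta> where "0 \<le> k" "0 \<le> \<beta>" "\<beta> \<le> 1" "k = 0 \<longrightarrow> \<beta> = 0"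
    "\<forall>x\<in>sign_cube r. h x = threshold_value k \<beta> (\<Sum>i=1..r. x i)"
    "k = 0 \<or> (\<beta> < 1 \<and> (\<exists>x\<in>sign_cube r. \<bar>\<Sum>i=1..r. x i\<bar> = k))"
proof -
  define R where "R = (\<lambda>k \<beta>. 0 \<le> \<beta> \<and> \<beta> \<le> 1 \<and> (k = 0 \<longrightarrow> \<beta> = 0) \<and>
     (\<forall>x\<in>sign_cube r. h x = threshold_value (int k) \<beta> (\<Sum>i=1..r. x i)))"
  obtain k0 \<beta>0 where k0: "0 \<le> k0" "0 \<le> \<beta>0 \<and> \<beta>0 \<le> 1 \<and> (k0 = 0 \<longrightarrow> \<beta>0 = 0) \<and>
     (\<forall>x\<in>sign_cube r. h x = threshold_value k0 \<beta>0 (\<Sum>i=1..r. x i))"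
    using assms unfolding semi_threshold_iff by blast
  then have "R (nat k0) \<beta>0" by (simp add: R_def)
  then have ex: "\<exists>k \<beta>. R k \<beta>" by blast
  define k where "k = (LEAST k. \<exists>\<beta>. R k \<beta>)"
  obtain \<beta> where R: "R k \<beta>" using LeastI_ex[OF ex] unfolding k_def by blast
  note \<beta> = R[unfolded R_def]
  have least: "\<not> R j \<gamma>" if "j < k" for j \<gamma>
    using not_less_Least[of j "\<lambda>k. \<exists>\<beta>. R k \<beta>"] that unfolding k_def by blast
  have "k = 0 \<or> (\<beta> < 1 \<and> (\<exists>x\<in>sign_cube r. \<bar>\<Sum>i=1..r. x i\<bar> = int k))"
  proof (rule ccontr)
    assume neg: "\<not> ?thesis"
    then have k: "k > 0" by simp
    \<comment> \<open>A level of full weight joins the region strictly above \<open>k - 1\<close>,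
      and an empty level does not matter; the values at \<open>k - 1\<close> are 0 already.\<close>
    have "R (k - 1) 0" unfolding R_def
    proof (intro conjI ballI impI)
      fix x assume x: "x \<in> sign_cube r"
      have "\<beta> = 1 \<or> \<bar>\<Sum>i=1..r. x i\<bar> \<noteq> int k" using neg \<beta> x by force
      moreover have "h x = threshold_value (int k) \<beta> (\<Sum>i=1..r. x i)" using \<beta> x by blast
      ultimately show "h x = threshold_value (int (k - 1)) 0 (\<Sum>i=1..r. x i)"
        using k unfolding threshold_value_def by (auto simp: of_nat_diff)
    qed auto
    with least[of "k - 1" 0] k show False by auto
  qed
  with that[of "int k" \<beta>] \<beta> show thesis by auto
qed

section \<open>Symmetries of the cube and conditional means\<close>

text \<open>Negation is an involution of the cube; \<open>restrict\<close> keeps the value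
  \<open>undefined\<close> outside the index set.\<close>

lemma sum_sign_cube_uminus:
  "(\<Sum>x\<in>sign_cube r. F (restrict (\<lambda>i. - x i) {1..r})) = (\<Sum>x\<in>sign_cube r. F x)"
  by (rule sum.reindex_bij_witness[where i = "\<lambda>x. restrict (\<lambda>i. - x i) {1..r}"
        and j = "\<lambda>x. restrict (\<lambda>i. - x i) {1..r}"])
    (auto simp: sign_cube_def PiE_def Pi_def extensional_def restrict_def fun_eq_iff)

lemma sum_sign_cube_transpose:
  assumes "i \<in> {1..r}" "j \<in> {1..r}"
  shows "(\<Sum>x\<in>sign_cube r. F (x \<circ> Transposition.transpose i j)) = (\<Sum>x\<in>sign_cube r. F x)"
proof -
  have *: "x \<circ> Transposition.transpose i j \<in> sign_cube r" if "x \<in> sign_cube r" for x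
    using that assms
    by (auto simp: sign_cube_def PiE_def Pi_def extensional_def Transposition.transpose_def)
  show ?thesis
    by (rule sum.reindex_bij_witness[where i = "\<lambda>x. x \<circ> Transposition.transpose i j"
          and j = "\<lambda>x. x \<circ> Transposition.transpose i j"])
      (use * in \<open>auto simp: o_assoc[symmetric] fun_eq_iff\<close>)
qed

lemma card_sign_cube_slice:
  assumes i: "i \<in> {1..r}" and s: "s = 1 \<or> s = -1"
  shows "2 * card (sign_cube r \<inter> {x. x i = s}) = 2 ^ r"
proof -
  have "(\<Sum>x\<in>sign_cube r. x i) = (\<Sum>x\<in>sign_cube r. - x i)"
    using sum_sign_cube_uminus[of "\<lambda>x. x i" r] i by simp
  then have z: "(\<Sum>x\<in>sign_cube r. x i) = 0" by (simp add: sum_negf)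
  have "2 * int (card (sign_cube r \<inter> {x. x i = s})) =
      (\<Sum>x\<in>sign_cube r. if x i = s then 2 else 0)"
    by (simp add: sum.If_cases)
  \<comment> \<open>For signs, \<open>1 + s * x i\<close> is twice the indicator of
    \<open>x i = s\<close>.\<close>
  also have "\<dots> = (\<Sum>x\<in>sign_cube r. 1 + s * x i)"
    using s sign_cube_coord[OF _ i] by (intro sum.cong) force+
  also have "\<dots> = 2 ^ r"
    by (simp add: sum.distrib z card_sign_cube flip: sum_distrib_left)
  finally have "int (2 * card (sign_cube r \<inter> {x. x i = s})) = int (2 ^ r)" by simp
  then show ?thesis by (simp only: of_nat_eq_iff)
qed

text \<open>An odd function has mean 0, so only its correlation with coordinate \<open>i\<close>
  survives conditioning. Hence both terms of the inner minimum in \<open>X_bar\<close>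
  agree.\<close>

lemma expectation_mu_half_cond_odd:
  fixes h :: "(nat \<Rightarrow> int) \<Rightarrow> real"
  assumes i: "i \<in> {1..r}" and s: "s = 1 \<or> s = -1"
    and odd: "\<And>x. x \<in> sign_cube r \<Longrightarrow> h (restrict (\<lambda>i. - x i) {1..r}) = - h x"
  shows "measure_pmf.expectation (cond_pmf (mu_half r) {x. x i = s}) h =
    s * (\<Sum>x\<in>sign_cube r. h x * x i) / 2 ^ r"
proof -
  let ?A = "sign_cube r \<inter> {x. x i = s}"
  have card: "2 * real (card ?A) = 2 ^ r"
    using arg_cong[OF card_sign_cube_slice[OF i s], of real] by simp
  then have ne: "?A \<noteq> {}" by (metis card.empty mult_zero_right of_nat_0 power_not_zero zero_neq_numeral)
  have "(\<Sum>x\<in>sign_cube r. h x) = (\<Sum>x\<in>sign_cube r. - h x)"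
    using sum_sign_cube_uminus[of h r] odd by simp
  then have z: "(\<Sum>x\<in>sign_cube r. h x) = 0" by (simp add: sum_negf)
  have "2 * sum h ?A = (\<Sum>x\<in>sign_cube r. if x i = s then 2 * h x else 0)"
    by (simp add: sum.If_cases sum_distrib_left)
  also have "\<dots> = (\<Sum>x\<in>sign_cube r. h x + s * (h x * x i))"
    using s sign_cube_coord[OF _ i] by (intro sum.cong) force+
  also have "\<dots> = s * (\<Sum>x\<in>sign_cube r. h x * x i)"
    by (simp add: sum.distrib z sum_distrib_left)
  finally have sum: "2 * sum h ?A = s * (\<Sum>x\<in>sign_cube r. h x * x i)" .
  have "measure_pmf.expectation (cond_pmf (mu_half r) {x. x i = s}) h = sum h ?A / real (card ?A)"
    unfolding mu_half_eq_pmf_of_set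
    using ne by (subst cond_pmf_of_set) (auto simp: sign_cube_nonempty integral_pmf_of_set)
  also have "\<dots> = (2 * sum h ?A) / (2 * real (card ?A))" by simp
  finally show ?thesis unfolding sum card .
qed

text \<open>Oddness equates the two conditional terms of each coordinate, and invariance under
  transpositions equates the coordinates. The minimum is thus over one value, and adding
  \<open>r\<close> copies restores the coordinate sum.\<close>

lemma X_bar_mu_half_threshold:
  assumes r: "r \<ge> 1" and k: "0 \<le> k" "k = 0 \<Longrightarrow> \<beta> = 0"
    and g: "\<And>x. x \<in> sign_cube r \<Longrightarrow> g x = threshold_value k \<beta> (\<Sum>i=1..r. x i)"
  shows "real r * X_bar r (mu_half r) g =
    (\<Sum>x\<in>sign_cube r. g x * real_of_int (\<Sum>i=1..r. x i)) / 2 ^ r"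
proof -
  define c where "c = (\<lambda>i. (\<Sum>x\<in>sign_cube r. g x * real_of_int (x i)) / 2 ^ r)"
  have neg: "restrict (\<lambda>i. - x i) {1..r} \<in> sign_cube r" if "x \<in> sign_cube r" for x
    using that by (auto simp: sign_cube_def PiE_def Pi_def)
  have odd: "g (restrict (\<lambda>i. - x i) {1..r}) = - g x" if x: "x \<in> sign_cube r" for x
    unfolding g[OF x] g[OF neg[OF x]] by (simp add: sum_negf threshold_value_uminus k)
  have ct: "c i = c j" if ij: "i \<in> {1..r}" "j \<in> {1..r}" for i j
  proof -
    let ?\<tau> = "Transposition.transpose i j"
    have "g (x \<circ> ?\<tau>) = g x" if x: "x \<in> sign_cube r" for x
    proof -
      have "x \<circ> ?\<tau> \<in> sign_cube r" using x ij
        by (auto simp: sign_cube_def PiE_def Pi_def extensional_def Transposition.transpose_def)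
      moreover have "(\<Sum>l=1..r. (x \<circ> ?\<tau>) l) = (\<Sum>l=1..r. x l)"
        using ij by (intro sum.permute[symmetric] permutes_swap_id)
      ultimately show ?thesis using g x by metis
    qed
    then have "(\<Sum>x\<in>sign_cube r. g (x \<circ> ?\<tau>) * real_of_int ((x \<circ> ?\<tau>) j)) =
        (\<Sum>x\<in>sign_cube r. g x * real_of_int (x i))" by simp
    then show ?thesis
      using sum_sign_cube_transpose[OF ij, of "\<lambda>x. g x * real_of_int (x j)"] by (simp add: c_def)
  qed
  have "X_bar r (mu_half r) g = Min (c ` {1..r})"
    unfolding X_bar_def
  proof (intro arg_cong[of _ _ Min] image_cong refl)
    fix i assume i: "i \<in> {1..r}"
    note cond = expectation_mu_half_cond_odd[of i r _ g, OF i _ odd]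
    show "min (measure_pmf.expectation (cond_pmf (mu_half r) {x. x i = 1}) g)
        (- measure_pmf.expectation (cond_pmf (mu_half r) {x. x i = -1}) g) = c i"
      using cond[of 1] cond[of "-1"] by (simp add: c_def)
  qed
  also have "c ` {1..r} = (\<lambda>_. c 1) ` {1..r}" using r by (intro image_cong refl ct) auto
  also have "\<dots> = {c 1}" using r by auto
  finally have "X_bar r (mu_half r) g = c 1" by simp
  then have "real r * X_bar r (mu_half r) g = (\<Sum>i=1..r. c 1)" by simp
  also have "\<dots> = (\<Sum>i=1..r. c i)" using r by (intro sum.cong refl ct) auto
  also have "\<dots> = (\<Sum>i=1..r. \<Sum>x\<in>sign_cube r. g x * real_of_int (x i)) / 2 ^ r"
    by (simp add: c_def sum_divide_distrib)
  also have "(\<Sum>i=1..r. \<Sum>x\<in>sign_cube r. g x * real_of_int (x i)) =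
      (\<Sum>x\<in>sign_cube r. g x * real_of_int (\<Sum>i=1..r. x i))"
    by (subst sum.swap) (simp add: sum_distrib_left)
  finally show ?thesis .
qed

section \<open>Maximality of the mean\<close>

text \<open>If \<open>k > 0\<close> and the mean is below \<open>\<alpha>\<close>, the weight of the
  nonempty level can be raised slightly, which contradicts maximality.\<close>

lemma maximal_threshold_level:
  assumes k: "0 \<le> k" "0 \<le> \<beta>" "\<beta> \<le> 1" "k = 0 \<Longrightarrow> \<beta> = 0"
    and g: "\<And>x. x \<in> sign_cube r \<Longrightarrow> g x = threshold_value k \<beta> (\<Sum>i=1..r. x i)"
    and canonical: "k = 0 \<or> (\<beta> < 1 \<and> (\<exists>x\<in>sign_cube r. \<bar>\<Sum>i=1..r. x i\<bar> = k))"
    and le: "measure_pmf.expectation (mu_half r) (\<lambda>x. \<bar>g x\<bar>) \<le> \<alpha>"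
    and maximal: "\<And>h. semi_threshold r h \<Longrightarrow>
       measure_pmf.expectation (mu_half r) (\<lambda>x. \<bar>h x\<bar>) \<le> \<alpha> \<Longrightarrow>
       measure_pmf.expectation (mu_half r) (\<lambda>x. \<bar>h x\<bar>)
         \<le> measure_pmf.expectation (mu_half r) (\<lambda>x. \<bar>g x\<bar>)"
  shows "k = 0 \<or> measure_pmf.expectation (mu_half r) (\<lambda>x. \<bar>g x\<bar>) = \<alpha>"
proof (rule ccontr)
  let ?E = "\<lambda>h :: (nat \<Rightarrow> int) \<Rightarrow> real. measure_pmf.expectation (mu_half r) (\<lambda>x. \<bar>h x\<bar>)"
  let ?S = "\<lambda>x :: nat \<Rightarrow> int. \<Sum>i=1..r. x i"
  assume neg: "\<not> ?thesis"
  then have lt: "?E g < \<alpha>" and k0: "k > 0" using le k by auto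
  obtain x0 where x0: "\<beta> < 1" "x0 \<in> sign_cube r" "\<bar>?S x0\<bar> = k" using canonical k0 by auto
  \<comment> \<open>The first bound keeps the new weight at most 1; the second keeps the mean at
    most \<open>\<alpha>\<close>, because the level has probability at most 1.\<close>
  define \<delta> where "\<delta> = min (1 - \<beta>) (\<alpha> - ?E g)"
  have \<delta>: "\<delta> > 0" "\<delta> \<le> 1 - \<beta>" "\<delta> \<le> \<alpha> - ?E g" using x0 lt by (auto simp: \<delta>_def)
  define h where "h = (\<lambda>x. threshold_value k (\<beta> + \<delta>) (?S x))"
  have semi: "semi_threshold r h"
    unfolding semi_threshold_iff h_def using k k0 \<delta> by (intro exI[of _ k] exI[of _ "\<beta> + \<delta>"]) auto
  have diff: "\<bar>h x\<bar> = \<bar>g x\<bar> + (if \<bar>?S x\<bar> = k then \<delta> else 0)" if "x \<in> sign_cube r" for x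
    using g[OF that] k k0 \<delta> by (auto simp: h_def threshold_value_def)
  define D where "D = (\<Sum>x\<in>sign_cube r. if \<bar>?S x\<bar> = k then \<delta> else 0)"
  have Eh: "?E h = ?E g + D / 2 ^ r"
    unfolding expectation_mu_half D_def by (simp add: diff sum.distrib add_divide_distrib)
  have "D \<le> (\<Sum>x\<in>sign_cube r. \<delta>)"
    unfolding D_def using \<delta> by (intro sum_mono) auto
  then have "D / 2 ^ r \<le> \<delta>" by (simp add: card_sign_cube field_simps)
  moreover have "D > 0"
    unfolding D_def using \<delta> x0 by (intro sum_pos2[of _ x0]) auto
  moreover from this have "D / 2 ^ r > 0" by simp
  ultimately show False using maximal[OF semi] Eh \<delta> by linarith
qed

section \<open>The bound for equipartite hypergraphs\<close>

lemma colouring_X_le_X_bar: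
  fixes V :: "'v set" and E :: "'v set set" and C :: "nat \<Rightarrow> 'v set"
  assumes r: "r \<ge> 1" and n: "n \<ge> 1"
    and H: "uniform_equipartite_hypergraph r n V E C"
    and semi: "semi_threshold r g"
    and le: "measure_pmf.expectation (mu_half r) (\<lambda>x. \<bar>g x\<bar>) \<le> real (card E) / real n ^ r"
    and maximal: "\<And>h. semi_threshold r h \<Longrightarrow>
       measure_pmf.expectation (mu_half r) (\<lambda>x. \<bar>h x\<bar>) \<le> real (card E) / real n ^ r \<Longrightarrow>
       measure_pmf.expectation (mu_half r) (\<lambda>x. \<bar>h x\<bar>)
         \<le> measure_pmf.expectation (mu_half r) (\<lambda>x. \<bar>g x\<bar>)"
    and f: "\<And>A. A \<in> E \<Longrightarrow> f A \<in> {-1, 1}" and f0: "(\<Sum>A\<in>E. f A) = 0"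
  shows "real_of_int (colouring_X V E f) \<le> X_bar r (mu_half r) g * real n ^ (r - 1)"
proof -
  define m where "m = real_of_int (colouring_X V E f)"
  define d where "d = (\<lambda>v. real_of_int (\<Sum>A | A \<in> E \<and> v \<in> A. f A))"
  have H': "finite V" "E \<subseteq> Pow V" "V = (\<Union>i\<in>{1..r}. C i)"
    and cardC: "\<And>i. i \<in> {1..r} \<Longrightarrow> card (C i) = n"
    and one: "\<And>A i. A \<in> E \<Longrightarrow> i \<in> {1..r} \<Longrightarrow> card (A \<inter> C i) = 1"
    using H by (auto simp: uniform_equipartite_hypergraph_def)
  have finE: "finite E" using H' by (meson finite_Pow_iff finite_subset)
  have finC: "finite (C i)" if "i \<in> {1..r}" for i
    using cardC[OF that] n by (intro card_ge_0_finite) simp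
  \<comment> \<open>Encodes an edge as a transversal, choosing its vertex in each class. As the
    classes cover \<open>V\<close>, the edge is the range of its code, which makes \<open>t\<close>
    injective on \<open>E\<close>.\<close>
  define t where "t = (\<lambda>A. \<lambda>i\<in>{1..r}. the_elem (A \<inter> C i))"
  have t: "A \<inter> C i = {t A i}" if A: "A \<in> E" and i: "i \<in> {1..r}" for A i
  proof -
    obtain v where "A \<inter> C i = {v}" using one[OF A i] card_1_singletonE by blast
    then show ?thesis using i by (simp add: t_def)
  qed
  have tQ: "t ` E \<subseteq> (\<Pi>\<^sub>E i\<in>{1..r}. C i)"
  proof (intro image_subsetI PiE_I)
    show "t A i \<in> C i" if "A \<in> E" "i \<in> {1..r}" for A i using t[OF that] by auto
  qed (auto simp: t_def)
  have A_eq: "A = t A ` {1..r}" if A: "A \<in> E" for A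
  proof -
    have "A = (\<Union>i\<in>{1..r}. A \<inter> C i)" using A H' by auto
    also have "\<dots> = (\<Union>i\<in>{1..r}. {t A i})" using t[OF A] by (intro SUP_cong) auto
    finally show ?thesis by auto
  qed
  have inj: "inj_on t E" by (rule inj_onI) (metis A_eq)
  \<comment> \<open>Double counting: each edge meets \<open>C i\<close> only in
    \<open>t A i\<close>. Constant \<open>w\<close> shows that the vertex sums of a class add up to
    zero; \<open>w = e i\<close> gives the main estimate.\<close>
  have class_sum: "(\<Sum>v\<in>C i. w v * d v) = (\<Sum>A\<in>E. real_of_int (f A) * w (t A i))"
    if i: "i \<in> {1..r}" for w :: "'v \<Rightarrow> real" and i
  proof -
    have "(\<Sum>v\<in>C i. w v * d v) = (\<Sum>v\<in>C i. \<Sum>A\<in>E. if v \<in> A then real_of_int (f A) * w v else 0)"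
      using finE by (simp add: d_def sum.inter_filter[symmetric] sum_distrib_left mult.commute)
    also have "\<dots> = (\<Sum>A\<in>E. \<Sum>v\<in>C i. if v \<in> A then real_of_int (f A) * w v else 0)"
      by (rule sum.swap)
    also have "\<dots> = (\<Sum>A\<in>E. real_of_int (f A) * w (t A i))"
    proof (intro sum.cong refl)
      fix A assume A: "A \<in> E"
      have "(\<Sum>v\<in>C i. if v \<in> A then real_of_int (f A) * w v else 0) =
          (\<Sum>v\<in>A \<inter> C i. real_of_int (f A) * w v)"
        using finC[OF i] by (simp add: Int_commute[of A] sum.inter_restrict)
      then show "(\<Sum>v\<in>C i. if v \<in> A then real_of_int (f A) * w v else 0) =
          real_of_int (f A) * w (t A i)" by (simp add: t[OF A i])
    qed
    finally show ?thesis .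
  qed
  have m_le: "m \<le> \<bar>d v\<bar>" if "v \<in> V" for v
  proof -
    have "colouring_X V E f \<le> \<bar>\<Sum>A | A \<in> E \<and> v \<in> A. f A\<bar>"
      unfolding colouring_X_def using H' that by (intro Min_le) auto
    then show ?thesis unfolding m_def d_def by linarith
  qed
  have "\<exists>w. (\<forall>v\<in>C i. \<bar>w v\<bar> \<le> 1) \<and> (\<Sum>v\<in>C i. w v) = 0 \<and>
      m * real n \<le> (\<Sum>v\<in>C i. w v * d v)" if i: "i \<in> {1..r}" for i
  proof -
    have "(\<Sum>v\<in>C i. d v) = real_of_int (\<Sum>A\<in>E. f A)"
      using class_sum[OF i, of "\<lambda>_. 1"] by simp
    moreover have "C i \<noteq> {}" using cardC[OF i] n by auto
    moreover have "C i \<subseteq> V" using H' i by auto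
    ultimately show ?thesis
      using exists_balancing_weights[of "C i" d m] finC[OF i] cardC[OF i] m_le f0 by auto
  qed
  then obtain e where e: "\<And>i v. i \<in> {1..r} \<Longrightarrow> v \<in> C i \<Longrightarrow> \<bar>e i v\<bar> \<le> 1"
    "\<And>i. i \<in> {1..r} \<Longrightarrow> (\<Sum>v\<in>C i. e i v) = 0"
    "\<And>i. i \<in> {1..r} \<Longrightarrow> m * real n \<le> (\<Sum>v\<in>C i. e i v * d v)"
    by metis
  obtain k \<beta> where k: "0 \<le> k" "0 \<le> \<beta>" "\<beta> \<le> 1" and k0: "k = 0 \<longrightarrow> \<beta> = 0"
    and g': "\<forall>x\<in>sign_cube r. g x = threshold_value k \<beta> (\<Sum>i=1..r. x i)"
    and canonical: "k = 0 \<or> (\<beta> < 1 \<and> (\<exists>x\<in>sign_cube r. \<bar>\<Sum>i=1..r. x i\<bar> = k))"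
    by (rule semi_threshold_obtain_canonical[OF semi])
  note k = k k0[rule_format] and g = g'[rule_format]
  let ?S = "\<lambda>x :: nat \<Rightarrow> int. real_of_int (\<Sum>i=1..r. x i)"
  have level: "k = 0 \<or> (\<Sum>x\<in>sign_cube r. \<bar>g x\<bar>) / 2 ^ r = real (card E) / real n ^ r"
    using maximal_threshold_level[OF k g canonical le maximal] by (simp add: expectation_mu_half)
  have excess: "max 0 (\<bar>?S x\<bar> - real_of_int k) = g x * ?S x - real_of_int k * \<bar>g x\<bar>"
    if "x \<in> sign_cube r" for x
    unfolding g[OF that] using k by (intro threshold_value_excess) auto
  have excess_sum: "(\<Sum>x\<in>sign_cube r. max 0 (\<bar>?S x\<bar> - real_of_int k)) =
      (\<Sum>x\<in>sign_cube r. g x * ?S x) - real_of_int k * (\<Sum>x\<in>sign_cube r. \<bar>g x\<bar>)"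
    unfolding sum_distrib_left sum_subtractf[symmetric] by (intro sum.cong refl excess)
  have "real r * (m * real n) = (\<Sum>i=1..r. m * real n)" by simp
  also have "\<dots> \<le> (\<Sum>i=1..r. \<Sum>A\<in>E. real_of_int (f A) * e i (t A i))"
    using e(3) by (intro sum_mono) (simp add: class_sum)
  also have "\<dots> = (\<Sum>A\<in>E. real_of_int (f A) * (\<Sum>i=1..r. e i (t A i)))"
    by (subst sum.swap) (simp add: sum_distrib_left)
  also have "\<dots> \<le> (\<Sum>A\<in>E. \<bar>\<Sum>i=1..r. e i (t A i)\<bar>)"
    using f by (intro sum_mono) fastforce
  also have "\<dots> = (\<Sum>s\<in>t ` E. \<bar>\<Sum>i=1..r. e i (s i)\<bar>)"
    by (simp add: sum.reindex[OF inj])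
  also have "\<dots> \<le> real_of_int k * real (card (t ` E)) +
      real n ^ r * ((\<Sum>x\<in>sign_cube r. max 0 (\<bar>?S x\<bar> - real_of_int k)) / 2 ^ r)"
    by (rule sum_abs_transversal_weights_le[OF finC cardC e(1,2) tQ])
  \<comment> \<open>The excess identity leaves \<open>k\<close> times the gap between
    \<open>card E\<close> and \<open>n ^ r\<close> times the mean of \<open>\<bar>g\<bar>\<close>.
    By \<open>level\<close>, either \<open>k\<close> or this gap is 0.\<close>
  also have "\<dots> = real n ^ r * ((\<Sum>x\<in>sign_cube r. g x * ?S x) / 2 ^ r) +
      real_of_int k * (real (card E) - real n ^ r * ((\<Sum>x\<in>sign_cube r. \<bar>g x\<bar>) / 2 ^ r))"
    unfolding excess_sum card_image[OF inj] by (simp add: diff_divide_distrib algebra_simps)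
  also have "\<dots> = real n ^ r * ((\<Sum>x\<in>sign_cube r. g x * ?S x) / 2 ^ r)"
    using level
  proof
    assume "(\<Sum>x\<in>sign_cube r. \<bar>g x\<bar>) / 2 ^ r = real (card E) / real n ^ r"
    then show ?thesis using n by (simp only:) simp
  qed simp
  also have "\<dots> = real n ^ r * (real r * X_bar r (mu_half r) g)"
    using X_bar_mu_half_threshold[OF r k(1,4) g] by simp
  \<comment> \<open>Splitting off one factor \<open>n\<close> exposes the common factor
    \<open>r * n\<close>, which is positive and can be cancelled.\<close>
  also have "\<dots> = real r * (X_bar r (mu_half r) g * real n ^ (r - 1) * real n)"
    using r by (simp add: power_eq_if)
  finally show ?thesis using r n by (simp add: m_def)
qed

theorem theorem2p1:
  fixes r n :: nat
    and V :: "'v set" and E :: "'v set set" and C :: "nat \<Rightarrow> 'v set"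
    and g :: "(nat \<Rightarrow> int) \<Rightarrow> real"
  assumes "r \<ge> 1" and "n \<ge> 1"
    and "uniform_equipartite_hypergraph r n V E C"
    and "semi_threshold r g"
    and "measure_pmf.expectation (mu_half r) (\<lambda>x. \<bar>g x\<bar>) \<le> real (card E) / real n ^ r"
    and "\<And>h. semi_threshold r h \<Longrightarrow>
           measure_pmf.expectation (mu_half r) (\<lambda>x. \<bar>h x\<bar>) \<le> real (card E) / real n ^ r \<Longrightarrow>
           measure_pmf.expectation (mu_half r) (\<lambda>x. \<bar>h x\<bar>)
             \<le> measure_pmf.expectation (mu_half r) (\<lambda>x. \<bar>g x\<bar>)"
  shows "(balanced_colourings E \<noteq> {} \<longrightarrow>
           real_of_int (hypergraph_X V E) \<le> X_bar r (mu_half r) g * real n ^ (r - 1)) \<and>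
         (\<forall>f. (\<forall>A\<in>E. f A \<in> {-1, 1}) \<longrightarrow> (\<Sum>A\<in>E. f A) = 0 \<longrightarrow>
           real_of_int (colouring_X V E f) \<le> X_bar r (mu_half r) g * real n ^ (r - 1))"
proof -
  have bound: "real_of_int (colouring_X V E f) \<le> X_bar r (mu_half r) g * real n ^ (r - 1)"
    if "\<forall>A\<in>E. f A \<in> {-1, 1}" "(\<Sum>A\<in>E. f A) = 0" for f
    using that by (intro colouring_X_le_X_bar[OF assms]) auto
  have "finite E"
    using assms(3) unfolding uniform_equipartite_hypergraph_def
    by (meson finite_Pow_iff finite_subset)
  \<comment> \<open>Balanced colourings are extensional on the finite set \<open>E\<close>, so there
    are finitely many and \<open>Max\<close> is attained whenever one exists.\<close>
  then have fin: "finite (balanced_colourings E)"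
    unfolding balanced_colourings_def by (simp add: finite_PiE)
  have "real_of_int (hypergraph_X V E) \<le> X_bar r (mu_half r) g * real n ^ (r - 1)"
    if "balanced_colourings E \<noteq> {}"
  proof -
    have "hypergraph_X V E \<in> colouring_X V E ` balanced_colourings E"
      unfolding hypergraph_X_def using fin that by (intro Max_in) auto
    then obtain f where "f \<in> balanced_colourings E" "hypergraph_X V E = colouring_X V E f"
      by blast
    then show ?thesis using bound[of f] by (auto simp: balanced_colourings_def PiE_def Pi_def)
  qed
  with bound show ?thesis by blast
qed

end
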